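(* Let $\operatorname{qn}_\ell(K_n)$ and $\operatorname{qn}_u(K_n)$ denote the local queue number and the union queue number of the complete graph $K_n$ on $n$ vertices. Then $$\operatorname{qn}_\ell(K_n) = \Bigl(1-\frac{1}{\sqrt{2}}\Bigr)n \pm \mathcal{O}(1) \quad\text{and}\quad \operatorname{qn}_u(K_n) = \Bigl(1-\frac{1}{\sqrt{2}}\Bigr)n \pm \mathcal{O}(1),$$ that is, there is an absolute constant $c$ such that for every integer $n\geq 1$ we have $\bigl|\operatorname{qn}_\ell(K_n) - (1-\tfrac{1}{\sqrt 2})n\bigr| \leq c$ and $\bigl|\operatorname{qn}_u(K_n) - (1-\tfrac{1}{\sqrt 2})n\bigr| \leq c$.
   Context: All graphs are finite and simple. A linear layout of a graph $G$ consists of a total ordering $\prec$ of $V(G)$ together with a partition of $E(G)$. For a fixed vertex ordering $\prec$, two independent edges (edges with no common endpoint) $vw$ and $xy$ with $v \prec w$ and $x \prec y$ nest if $v \prec x \prec y \prec w$ or $x \prec v \prec w \prec y$. A queue (with respect to $\prec$) is a set of edges that are pairwise non-nesting. A union queue (with respect to $\prec$) is a vertex-disjoint union of queues, i.e. a set of edges that is a union of queues no two of which contain edges incident to a common vertex. A queue layout is a linear layout in which every part of the edge partition is a queue. It is $k$-local if each vertex has incident edges in at most $k$ parts of the partition. The local queue number $\operatorname{qn}_\ell(G)$ is the smallest $k$ such that $G$ has a $k$-local queue layout (for some vertex ordering; the total number of queues is unrestricted). The union queue number $\operatorname{qn}_u(G)$ is the smallest $k$ such that there are a vertex ordering of $G$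 and a partition of $E(G)$ into at most $k$ union queues. *)

theory Defs
  imports Complex_Main "HOL-Library.Disjoint_Sets" "HOL-Library.Ramsey"
begin

text \<open>
  A graph is given by its vertex set \<open>V\<close> and its set \<open>E\<close> of edges, each edge being a two-element
  set of vertices. A vertex ordering is a strict order relation \<open>r\<close>, where \<open>(v, w) \<in> r\<close> means that
  \<open>v\<close> comes before \<open>w\<close>. Only the restriction of \<open>r\<close> to \<open>V\<close> is relevant.
\<close>

definition simple_graph :: "'a set \<Rightarrow> 'a set set \<Rightarrow> bool" where
  "simple_graph V E \<longleftrightarrow> finite V \<and> E \<subseteq> [V]\<^bsup>2\<^esup>"

definition nest :: "'a rel \<Rightarrow> 'a set \<Rightarrow> 'a set \<Rightarrow> bool" where
  "nest r e f \<longleftrightarrow> e \<inter> f = {} \<and>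
     (\<exists>v w x y. e = {v, w} \<and> f = {x, y} \<and> (v, w) \<in> r \<and> (x, y) \<in> r \<and>
        ((v, x) \<in> r \<and> (x, y) \<in> r \<and> (y, w) \<in> r \<or>
         (x, v) \<in> r \<and> (v, w) \<in> r \<and> (w, y) \<in> r))"

definition queue :: "'a rel \<Rightarrow> 'a set set \<Rightarrow> bool" where
  "queue r Q \<longleftrightarrow> (\<forall>e\<in>Q. \<forall>f\<in>Q. \<not> nest r e f)"

text \<open>For a set \<open>Q\<close> of edges, \<open>\<Union>Q\<close> is the set of vertices incident to an edge in \<open>Q\<close>.\<close>

definition union_queue :: "'a rel \<Rightarrow> 'a set set \<Rightarrow> bool" where
  "union_queue r U \<longleftrightarrow> (\<exists>\<Q>. U = \<Union>\<Q> \<and> (\<forall>Q\<in>\<Q>. queue r Q) \<and>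
     (\<forall>Q\<in>\<Q>. \<forall>Q'\<in>\<Q>. Q \<noteq> Q' \<longrightarrow> \<Union>Q \<inter> \<Union>Q' = {}))"

definition linear_layout :: "'a set \<Rightarrow> 'a set set \<Rightarrow> 'a rel \<Rightarrow> 'a set set set \<Rightarrow> bool" where
  "linear_layout V E r P \<longleftrightarrow> strict_linear_order_on V r \<and> partition_on E P"

definition queue_layout :: "'a set \<Rightarrow> 'a set set \<Rightarrow> 'a rel \<Rightarrow> 'a set set set \<Rightarrow> bool" where
  "queue_layout V E r P \<longleftrightarrow> linear_layout V E r P \<and> (\<forall>Q\<in>P. queue r Q)"

definition union_queue_layout :: "'a set \<Rightarrow> 'a set set \<Rightarrow> 'a rel \<Rightarrow> 'a set set set \<Rightarrow> bool" where
  "union_queue_layout V E r P \<longleftrightarrow> linear_layout V E r P \<and> (\<forall>U\<in>P. union_queue r U)"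

definition local_layout :: "nat \<Rightarrow> 'a set \<Rightarrow> 'a set set set \<Rightarrow> bool" where
  "local_layout k V P \<longleftrightarrow> (\<forall>v\<in>V. card {Q \<in> P. v \<in> \<Union>Q} \<le> k)"

text \<open>
  Both parameters are meant for finite simple graphs only; there every edge partition is finite,
  so the cardinalities are the intended ones, and the minima exist by the lemmas below.
\<close>

definition local_queue_number :: "'a set \<Rightarrow> 'a set set \<Rightarrow> nat" where
  "local_queue_number V E = (LEAST k. \<exists>r P. queue_layout V E r P \<and> local_layout k V P)"

definition union_queue_number :: "'a set \<Rightarrow> 'a set set \<Rightarrow> nat" where
  "union_queue_number V E = (LEAST k. \<exists>r P. union_queue_layout V E r P \<and> card P \<le> k)"

definition complete_edges :: "nat \<Rightarrow> nat set set" where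
  "complete_edges n = [{..<n}]\<^bsup>2\<^esup>"

lemma simple_graph_complete: "simple_graph {..<n} (complete_edges n)"
  by (simp add: simple_graph_def complete_edges_def)

lemma finite_edge_partition:
  assumes "simple_graph V E" "linear_layout V E r P"
  shows "finite P"
proof -
  have "finite E"
    using assms(1) by (auto simp: simple_graph_def intro: finite_subset finite_imp_finite_nsets)
  then show ?thesis
    using assms(2) finite_elements by (auto simp: linear_layout_def)
qed

lemma ex_queue_layout:
  assumes "simple_graph V E"
  obtains r P where "queue_layout V E r P"
proof -
  have "finite V" using assms by (simp add: simple_graph_def)
  then obtain f :: "'a \<Rightarrow> nat" where f: "inj_on f V"
    using finite_imp_inj_to_nat_seg by metis
  define r where "r = {(v, w). f v < f w}"
  have "strict_linear_order_on V r"
    using f by (fastforce simp: strict_linear_order_on_def r_def trans_def irrefl_def total_on_def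
        inj_on_def neq_iff)
  moreover have "partition_on E ((\<lambda>e. {e}) ` E)"
    by (auto simp: partition_on_def disjoint_def)
  moreover have "queue r {e}" if "e \<in> E" for e
    using that assms by (auto simp: queue_def nest_def)
  ultimately show ?thesis
    using that[of r "(\<lambda>e. {e}) ` E"] by (auto simp: queue_layout_def linear_layout_def)
qed

lemma local_queue_number_attained:
  assumes "simple_graph V E"
  shows "\<exists>r P. queue_layout V E r P \<and> local_layout (local_queue_number V E) V P"
  unfolding local_queue_number_def
proof (rule LeastI_ex)
  obtain r P where rP: "queue_layout V E r P"
    using ex_queue_layout[OF assms] .
  then have "finite P"
    using finite_edge_partition[OF assms] by (auto simp: queue_layout_def)
  then have "local_layout (card P) V P"
    by (auto simp: local_layout_def intro: card_mono)
  with rP show "\<exists>k r P. queue_layout V E r P \<and> local_layout k V P" by blast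
qed

lemma union_queue_number_attained:
  assumes "simple_graph V E"
  shows "\<exists>r P. union_queue_layout V E r P \<and> card P \<le> union_queue_number V E"
  unfolding union_queue_number_def
proof (rule LeastI_ex)
  obtain r P where rP: "queue_layout V E r P"
    using ex_queue_layout[OF assms] .
  have "union_queue r Q" if "queue r Q" for Q
    unfolding union_queue_def using that by (intro exI[of _ "{Q}"]) auto
  with rP have "union_queue_layout V E r P"
    by (simp add: queue_layout_def union_queue_layout_def)
  then show "\<exists>k r P. union_queue_layout V E r P \<and> card P \<le> k" by blast
qed

end

theory Submission
  imports Defs
begin

text \<open>
  Lower bound. In a queue, call an edge (v, w) with v before w a first edge of w if v is the first
  left partner of w in that queue. Every queue contributes at most one first edge to w. It also
  contributes at most one edge that is not first to v as left endpoint: if (v, w) and (v, w') with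
  w before w' were two of them, the first edge (u, w') of w' would nest around (v, w). In a
  k-local layout a vertex meets at most k queues, and the vertex in position i has only i left
  partners and n - 1 - i right partners, so n(n-1)/2 is at most twice the sum of min k i over i <
  n, that is, 2kn - k^2 - k. Solving this quadratic inequality gives k \<ge> (1 - 1/sqrt 2) n -
  O(1). This is \<open>local_queue_number_complete_ge\<close>. Splitting every union queue into
  its queues shows that the local queue number is at most the union queue number, so it remains to
  bound the latter from above.

  Upper bound. For near equality in this count, almost every vertex with at least k left and k
  right partners has to be both a left and a right endpoint in almost every union queue. Let b be
  close to sqrt 2 m, and take N = 8m + 6b + 3 vertices and k = 2m + 2b + 1 union queues; then k/N
  tends to (2 + 2 sqrt 2)/(8 + 6 sqrt 2) = 1 - 1/sqrt 2. Think of an edge {x, y} with x < y as the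
  point (x, y); a set of edges is a queue exactly if its points form a chain in the componentwise
  order. The union queue with index a < k has two ingredients.

  \<^item> A monotone lattice path on the vertices a, ..., N - 1 - a, which climbs the column of
  a, then follows the two diagonals y - x = 2(k - a) - 1 and y - x = 2(k - a) as a staircase, and
  leaves along the row of N - 1 - a. These paths are nested inside each other and cover all edges
  with y - x \<le> 2k.

  \<^item> Stars whose leaves are among the 2a vertices outside of the path. Write z' for the
  mirror image N - 1 - z. The edges that the paths miss are the edges {x, z'} with x + z < H = 4m
  + 2b. Orienting the pair {x, z} as x \<rightarrow> z and giving it to index a > x means that {x,
  z'} is put into a star centered at z' and {x', z} into a star centered at z. A vertex x < a can
  be a leaf for one center only, and to keep the stars apart from everything else, their centers
  are removed from the path and from the leaves. If an index uses only boundedly many centers,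
  this loses few edges.

  So one needs an orientation of the pairs with x + z < H, and a schedule that tells the center of
  leaf x at index a. The points (x, z) with x + z < H form a triangle with legs of length about
  sqrt 2 k, which makes about k^2/2 pairs {x, z}. There are equally many slots (x, a) with x < a <
  k, up to O(k), and \<open>center\<close> matches pairs and slots block by block. Its crucial
  part is a rotation with irrational ratio, for which 2m^2 \<le> b^2 is needed
  (\<open>center_exists_two_blocks\<close>).

  The lost edges are contained in a constant number of families of edges {p(a), q(a)}, where p and
  q are injective in the index a. The edges of such a family form paths and cycles and are
  therefore covered by three matchings, and a matching is a union queue
  (\<open>coverable_injective_families\<close>). Hence k + O(1) union queues cover all edges
  (\<open>coverable_complete_edges\<close>), and a cover can be thinned out to a partition because
  subsets of union queues are union queues.
\<close>

section \<open>Counting edges by first partners\<close>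

text \<open>
  The number of predecessors is a bijection from V onto the positions 0, ..., |V| - 1.
\<close>

lemma sum_min_predecessors:
  assumes V: "finite V" and s: "trans s" "irrefl s" "total_on V s"
  shows "(\<Sum>v\<in>V. min k (card {u \<in> V. (u, v) \<in> s})) = (\<Sum>i<card V. min k i)"
proof -
  define d where "d v = card {u \<in> V. (u, v) \<in> s}" for v
  have less: "d u < d v" if "u \<in> V" "v \<in> V" "(u, v) \<in> s" for u v
    unfolding d_def
  proof (rule psubset_card_mono)
    show "finite {u \<in> V. (u, v) \<in> s}" using V by simp
    have "(u, u) \<notin> s" using s(2) by (simp add: irrefl_def)
    moreover have "(w, v) \<in> s" if "(w, u) \<in> s" for w
      using that \<open>(u, v) \<in> s\<close> s(1) by (rule transD[rotated])
    ultimately show "{w \<in> V. (w, u) \<in> s} \<subset> {u \<in> V. (u, v) \<in> s}" using that by blast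
  qed
  have inj: "inj_on d V"
  proof (rule inj_onI, rule ccontr)
    fix u v assume *: "u \<in> V" "v \<in> V" "d u = d v" "u \<noteq> v"
    then have "(u, v) \<in> s \<or> (v, u) \<in> s" using s(3) by (auto simp: total_on_def)
    then show False using less[of u v] less[of v u] * by auto
  qed
  have "d ` V \<subseteq> {..<card V}"
  proof
    fix i assume "i \<in> d ` V"
    then obtain v where v: "v \<in> V" "i = d v" by blast
    have "v \<notin> {u \<in> V. (u, v) \<in> s}" using s(2) by (simp add: irrefl_def)
    then have "{u \<in> V. (u, v) \<in> s} \<subset> V" using v(1) by blast
    then show "i \<in> {..<card V}" using v(2) V by (simp add: d_def psubset_card_mono)
  qed
  then have "d ` V = {..<card V}"
    using inj by (intro card_subset_eq) (auto simp: card_image)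
  then have "bij_betw d V {..<card V}" using inj by (simp add: bij_betw_def)
  then have "(\<Sum>v\<in>V. min k (d v)) = (\<Sum>i<card V. min k i)"
    by (rule sum.reindex_bij_betw)
  then show ?thesis by (simp add: d_def)
qed

text \<open>
  The edges are split into the set R of first edges and the set L of the others. First edges with
  the same right end lie in different queues, and so do the other edges with the same left end;
  the number of queues at a vertex is at most k, and the number of partners is a number of
  predecessors in r or in the converse of r.
\<close>

lemma card_edges_le_sum_min:
  assumes V: "finite V" and lay: "queue_layout V ([V]\<^bsup>2\<^esup>) r P" and loc: "local_layout k V P"
  shows "card ([V]\<^bsup>2\<^esup>) \<le> 2 * (\<Sum>i<card V. min k i)"
proof -
  let ?E = "[V]\<^bsup>2\<^esup>"
  have r: "trans r" "irrefl r" "total_on V r" and part: "partition_on ?E P"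
    and queue: "\<And>Q. Q \<in> P \<Longrightarrow> queue r Q"
    using lay by (auto simp: queue_layout_def linear_layout_def strict_linear_order_on_def)
  have ne: "v \<noteq> w" if "(v, w) \<in> r" for v w using that r(2) by (auto simp: irrefl_def)
  have tr: "(u, w) \<in> r" if "(u, v) \<in> r" "(v, w) \<in> r" for u v w
    using that r(1) by (rule transD[rotated])
  have "simple_graph V ?E" using V by (simp add: simple_graph_def)
  then have "finite P" using finite_edge_partition lay by (auto simp: queue_layout_def)
  define A where "A = {(v, w). v \<in> V \<and> w \<in> V \<and> (v, w) \<in> r}"
  have finA: "finite A" by (rule finite_subset[of _ "V \<times> V"]) (use V in \<open>auto simp: A_def\<close>)
  \<comment> \<open>Edges are handled as arcs directed along the vertex ordering.\<close>
  have "bij_betw (\<lambda>(v, w). {v, w}) A ?E"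
    unfolding bij_betw_def
  proof
    show "inj_on (\<lambda>(v, w). {v, w}) A"
    proof (rule inj_onI, clarify)
      fix v w v' w' assume *: "(v, w) \<in> A" "(v', w') \<in> A" "{v, w} = {v', w'}"
      then have "(v, w) \<in> r" "(v', w') \<in> r" by (auto simp: A_def)
      then have "\<not> (v = w' \<and> w = v')" using ne tr by blast
      then show "v = v' \<and> w = w'" using *(3) by (auto simp: doubleton_eq_iff)
    qed
    show "(\<lambda>(v, w). {v, w}) ` A = ?E"
    proof (intro equalityI subsetI)
      fix e assume "e \<in> ?E"
      then obtain x y where xy: "x \<in> V" "y \<in> V" "x \<noteq> y" "e = {x, y}" by (auto simp: nsets_2_eq)
      then have "(x, y) \<in> A \<or> (y, x) \<in> A" using r(3) by (auto simp: A_def total_on_def)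
      then show "e \<in> (\<lambda>(v, w). {v, w}) ` A" using xy(4) by (force simp: insert_commute)
    qed (auto simp: A_def dest: ne)
  qed
  then have cardE: "card ?E = card A" by (simp add: bij_betw_same_card)
  have "\<forall>e\<in>?E. \<exists>Q\<in>P. e \<in> Q" using part by (auto simp: partition_on_def)
  then obtain q where q: "\<And>e. e \<in> ?E \<Longrightarrow> q e \<in> P \<and> e \<in> q e" by metis
  have qA: "q {v, w} \<in> P" "{v, w} \<in> q {v, w}" if "(v, w) \<in> A" for v w
    using that q[of "{v, w}"] by (auto simp: A_def dest: ne)
  have ends: "q {v, w} \<in> {Q \<in> P. v \<in> \<Union>Q}" "q {v, w} \<in> {Q \<in> P. w \<in> \<Union>Q}" if "(v, w) \<in> A" for v w
    using qA[OF that] by blast+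
  have few: "card (f ` X) \<le> k" if "v \<in> V" "f ` X \<subseteq> {Q \<in> P. v \<in> \<Union>Q}" for f :: "'a \<Rightarrow> 'a set set" and X v
  proof -
    have "card (f ` X) \<le> card {Q \<in> P. v \<in> \<Union>Q}" using that(2) \<open>finite P\<close> by (intro card_mono) auto
    also have "\<dots> \<le> k" using loc that(1) by (simp add: local_layout_def)
    finally show ?thesis .
  qed
  define R where "R = {(v, w) \<in> A. \<not> (\<exists>u. (u, w) \<in> A \<and> (u, v) \<in> r \<and> q {u, w} = q {v, w})}"
  define L where "L = A - R"
  have "card {v. (v, w) \<in> R} \<le> min k (card {u \<in> V. (u, w) \<in> r})" if "w \<in> V" for w
  proof -
    have "inj_on (\<lambda>v. q {v, w}) {v. (v, w) \<in> R}"
    proof (rule inj_onI, rule ccontr)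
      fix u v assume *: "u \<in> {v. (v, w) \<in> R}" "v \<in> {v. (v, w) \<in> R}" "q {u, w} = q {v, w}" "u \<noteq> v"
      then have "(u, v) \<in> r \<or> (v, u) \<in> r" using r(3) by (auto simp: total_on_def R_def A_def)
      then show False using * by (auto simp: R_def)
    qed
    then have "card {v. (v, w) \<in> R} = card ((\<lambda>v. q {v, w}) ` {v. (v, w) \<in> R})"
      by (simp add: card_image)
    also have "\<dots> \<le> k" using ends(2) by (intro few[OF that]) (auto simp only: R_def)
    finally have "card {v. (v, w) \<in> R} \<le> k" .
    moreover have "card {v. (v, w) \<in> R} \<le> card {u \<in> V. (u, w) \<in> r}"
      using V by (intro card_mono) (auto simp: R_def A_def)
    ultimately show ?thesis by simp
  qed
  moreover have "card {w. (v, w) \<in> L} \<le> min k (card {w \<in> V. (w, v) \<in> r\<inverse>})" if "v \<in> V" for v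
  proof -
    \<comment> \<open>The first partner of the later right end yields an edge around the edge to the earlier one.\<close>
    have nonest: False if h: "(v, w) \<in> L" "(v, w') \<in> L" "q {v, w} = q {v, w'}" "(w, w') \<in> r" for w w'
    proof -
      obtain u where u: "(u, w') \<in> A" "(u, v) \<in> r" "q {u, w'} = q {v, w'}"
        using h(2) by (auto simp: L_def R_def)
      have vw: "(v, w) \<in> A" using h(1) by (simp add: L_def)
      then have "(v, w) \<in> r" by (simp add: A_def)
      moreover have "(u, w') \<in> r" using u(1) by (simp add: A_def)
      moreover have "{v, w} \<inter> {u, w'} = {}"
      proof -
        have "v \<noteq> u" "w \<noteq> w'" using ne u(2) h(4) by blast+
        moreover have "w \<noteq> u" using ne tr[OF u(2) \<open>(v, w) \<in> r\<close>] by blast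
        moreover have "v \<noteq> w'" using ne tr[OF \<open>(v, w) \<in> r\<close> h(4)] by blast
        ultimately show ?thesis by blast
      qed
      ultimately have "nest r {v, w} {u, w'}"
        unfolding nest_def using u(2) h(4) by blast
      moreover have "{v, w} \<in> q {v, w}" "{u, w'} \<in> q {v, w}" "q {v, w} \<in> P"
        using qA[OF vw] qA[OF u(1)] u(3) h(3) by auto
      ultimately show False using queue unfolding queue_def by blast
    qed
    have "inj_on (\<lambda>w. q {v, w}) {w. (v, w) \<in> L}"
    proof (rule inj_onI, rule ccontr)
      fix w w' assume *: "w \<in> {w. (v, w) \<in> L}" "w' \<in> {w. (v, w) \<in> L}" "q {v, w} = q {v, w'}" "w \<noteq> w'"
      then have "(w, w') \<in> r \<or> (w', w) \<in> r" using r(3) by (auto simp: total_on_def L_def A_def)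
      then show False using nonest[of w w'] nonest[of w' w] * by auto
    qed
    then have "card {w. (v, w) \<in> L} = card ((\<lambda>w. q {v, w}) ` {w. (v, w) \<in> L})"
      by (simp add: card_image)
    also have "\<dots> \<le> k" using ends(1) by (intro few[OF that]) (auto simp only: L_def)
    finally have "card {w. (v, w) \<in> L} \<le> k" .
    moreover have "card {w. (v, w) \<in> L} \<le> card {w \<in> V. (w, v) \<in> r\<inverse>}"
      using V by (intro card_mono) (auto simp: L_def A_def)
    ultimately show ?thesis by simp
  qed
  moreover have "card R = (\<Sum>w\<in>V. card {v. (v, w) \<in> R})"
  proof -
    have "R = prod.swap ` (SIGMA w:V. {v. (v, w) \<in> R})" by (force simp: R_def A_def)
    then have "card R = card (SIGMA w:V. {v. (v, w) \<in> R})"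
      by (metis card_image inj_swap)
    also have "\<dots> = (\<Sum>w\<in>V. card {v. (v, w) \<in> R})"
      using V by (intro card_SigmaI) (auto intro: finite_subset[of _ V] simp: R_def A_def)
    finally show ?thesis .
  qed
  moreover have "card L = (\<Sum>v\<in>V. card {w. (v, w) \<in> L})"
  proof -
    have "L = (SIGMA v:V. {w. (v, w) \<in> L})" by (auto simp: L_def A_def)
    then have "card L = card (SIGMA v:V. {w. (v, w) \<in> L})" by simp
    also have "\<dots> = (\<Sum>v\<in>V. card {w. (v, w) \<in> L})"
      using V by (intro card_SigmaI) (auto intro: finite_subset[of _ V] simp: L_def A_def)
    finally show ?thesis .
  qed
  moreover have "card A = card R + card L"
  proof -
    have "A \<inter> R = R" by (auto simp: R_def)
    then show ?thesis using card_Int_Diff[OF finA, of R] by (simp add: L_def)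
  qed
  ultimately have "card A \<le> (\<Sum>w\<in>V. min k (card {u \<in> V. (u, w) \<in> r}))
      + (\<Sum>v\<in>V. min k (card {w \<in> V. (w, v) \<in> r\<inverse>}))"
    by (simp add: add_mono sum_mono)
  also have "\<dots> = 2 * (\<Sum>i<card V. min k i)"
    using sum_min_predecessors[OF V r] sum_min_predecessors[OF V, of "r\<inverse>"] r by simp
  finally show ?thesis using cardE by simp
qed

lemma sum_min_closed_form:
  fixes k n :: nat
  assumes "k \<le> n"
  shows "2 * (\<Sum>i<n. min k i) + k * k + k = 2 * k * n"
  using assms
proof (induction n rule: dec_induct)
  case base
  have "(\<Sum>i<k. min k i) = (\<Sum>i<k. i)" by (intro sum.cong) auto
  moreover have "2 * (\<Sum>i<k. i) + k = k * k" by (induction k) auto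
  ultimately show ?case by simp
qed (auto simp: algebra_simps)

text \<open>
  For k \<le> n the count reads n^2 - n \<le> 4kn - 2k^2 - 2k, which is a bound on the square of n
  - k.
\<close>

lemma local_queue_number_complete_ge:
  "(1 - 1 / sqrt 2) * real n - 1 \<le> real (local_queue_number {..<n} (complete_edges n))"
proof -
  define k where "k = local_queue_number {..<n} (complete_edges n)"
  obtain r P where rP: "queue_layout {..<n} (complete_edges n) r P" "local_layout k {..<n} P"
    using local_queue_number_attained[OF simple_graph_complete, of n] unfolding k_def by blast
  show ?thesis
  proof (cases "k \<le> n")
    case True
    have "n choose 2 \<le> 2 * (\<Sum>i<n. min k i)"
      using card_edges_le_sum_min[of "{..<n}" r P k] rP by (simp add: complete_edges_def)
    then have "2 * (n choose 2) + 2 * (k * k) + 2 * k \<le> 4 * k * n"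
      using sum_min_closed_form[OF True] by linarith
    moreover have "2 * (n choose 2) + n = n * n"
      by (induction n) (auto simp: numeral_2_eq_2)
    ultimately have "n * n + 2 * (k * k) + 2 * k \<le> 4 * k * n + n" by linarith
    then have "real (n * n + 2 * (k * k) + 2 * k) \<le> real (4 * k * n + n)"
      by (simp only: of_nat_le_iff)
    then have "2 * (real n - real k)\<^sup>2 \<le> (real n + 1)\<^sup>2"
      by (simp add: power2_eq_square algebra_simps)
    then have "(real n - real k)\<^sup>2 \<le> ((real n + 1) / sqrt 2)\<^sup>2"
      by (simp add: power_divide)
    then have "real n - real k \<le> (real n + 1) / sqrt 2"
      by (rule power2_le_imp_le) simp
    moreover have "(real n + 1) / sqrt 2 = real n / sqrt 2 + 1 / sqrt 2"
      by (rule add_divide_distrib)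
    moreover have "1 / sqrt 2 \<le> (1::real)" by simp
    ultimately have "real n - real n / sqrt 2 \<le> real k + 1" by linarith
    then show ?thesis unfolding k_def[symmetric] by (simp add: algebra_simps)
  next
    case False
    have "(1 - 1 / sqrt 2) * real n \<le> 1 * real n" by (intro mult_right_mono) auto
    then show ?thesis using False unfolding k_def[symmetric] by simp
  qed
qed

section \<open>Union queues and coverings by them\<close>

text \<open>
  The label of a vertex names the queue of the vertex-disjoint union to which the vertex belongs.
\<close>

lemma union_queue_if_labelled:
  fixes lab :: "'a \<Rightarrow> 'b"
  assumes const: "\<And>e v w. e \<in> U \<Longrightarrow> v \<in> e \<Longrightarrow> w \<in> e \<Longrightarrow> lab v = lab w"
    and nonest: "\<And>e f v w. e \<in> U \<Longrightarrow> f \<in> U \<Longrightarrow> v \<in> e \<Longrightarrow> w \<in> f \<Longrightarrow> lab v = lab w \<Longrightarrow> \<not> nest r e f"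
  shows "union_queue r U"
proof -
  define Q where "Q l = {e \<in> U. lab ` e \<subseteq> {l}}" for l
  have "U = \<Union>(range Q)"
  proof -
    have "e \<in> \<Union>(range Q)" if "e \<in> U" for e
    proof (cases "e = {}")
      case False
      then obtain v where "v \<in> e" by blast
      have "lab w = lab v" if "w \<in> e" for w using const[OF \<open>e \<in> U\<close> that \<open>v \<in> e\<close>] .
      then have "e \<in> Q (lab v)" using \<open>e \<in> U\<close> by (auto simp: Q_def)
      then show ?thesis by blast
    qed (use that in \<open>auto simp: Q_def\<close>)
    moreover have "\<Union>(range Q) \<subseteq> U" by (auto simp: Q_def)
    ultimately show ?thesis by blast
  qed
  moreover have "queue r (Q l)" for l
    unfolding queue_def
  proof (intro ballI notI)
    fix e f assume "e \<in> Q l" "f \<in> Q l" and n: "nest r e f"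
    from n obtain v w where "v \<in> e" "w \<in> f" by (auto simp: nest_def)
    moreover have "e \<in> U" "f \<in> U" using \<open>e \<in> Q l\<close> \<open>f \<in> Q l\<close> by (auto simp: Q_def)
    moreover have "lab v = lab w"
      using \<open>e \<in> Q l\<close> \<open>f \<in> Q l\<close> \<open>v \<in> e\<close> \<open>w \<in> f\<close> unfolding Q_def by blast
    ultimately show False using n nonest by blast
  qed
  moreover have "\<Union>(Q l) \<inter> \<Union>(Q l') = {}" if "Q l \<noteq> Q l'" for l l'
  proof -
    have "lab v = i" if "v \<in> \<Union>(Q i)" for v i using that by (auto simp: Q_def)
    moreover have "l \<noteq> l'" using that by blast
    ultimately show ?thesis by blast
  qed
  ultimately show ?thesis
    unfolding union_queue_def by (intro exI[of _ "range Q"]) auto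
qed

lemma union_queue_subset:
  assumes "union_queue r U" "U' \<subseteq> U"
  shows "union_queue r U'"
proof -
  obtain \<Q> where Q: "U = \<Union>\<Q>" "\<forall>Q\<in>\<Q>. queue r Q"
    "\<forall>Q\<in>\<Q>. \<forall>Q'\<in>\<Q>. Q \<noteq> Q' \<longrightarrow> \<Union>Q \<inter> \<Union>Q' = {}"
    using assms(1) unfolding union_queue_def by (elim exE conjE)
  show ?thesis
    unfolding union_queue_def
  proof (intro exI[of _ "(\<lambda>Q. Q \<inter> U') ` \<Q>"] conjI ballI impI)
    show "U' = \<Union>((\<lambda>Q. Q \<inter> U') ` \<Q>)" using Q(1) assms(2) by auto
    show "queue r A" if A: "A \<in> (\<lambda>Q. Q \<inter> U') ` \<Q>" for A
    proof -
      obtain Q where "Q \<in> \<Q>" "A = Q \<inter> U'" using A by blast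
      then show ?thesis using Q(2) unfolding queue_def by blast
    qed
    show "\<Union>A \<inter> \<Union>B = {}"
      if AB: "A \<in> (\<lambda>Q. Q \<inter> U') ` \<Q>" "B \<in> (\<lambda>Q. Q \<inter> U') ` \<Q>" "A \<noteq> B" for A B
    proof -
      obtain Q Q' where QQ: "Q \<in> \<Q>" "Q' \<in> \<Q>" "A = Q \<inter> U'" "B = Q' \<inter> U'" "Q \<noteq> Q'"
        using AB by blast
      have "\<Union>A \<subseteq> \<Union>Q" "\<Union>B \<subseteq> \<Union>Q'" using QQ by auto
      then show ?thesis using Q(3) QQ(1,2,5) by blast
    qed
  qed
qed

lemma union_queue_matching:
  assumes "\<And>e f. e \<in> U \<Longrightarrow> f \<in> U \<Longrightarrow> e \<noteq> f \<Longrightarrow> e \<inter> f = {}"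
  shows "union_queue r U"
  unfolding union_queue_def
proof (intro exI[of _ "(\<lambda>e. {e}) ` U"] conjI ballI impI)
  show "queue r Q" if "Q \<in> (\<lambda>e. {e}) ` U" for Q
    using that by (auto simp: queue_def nest_def)
qed (use assms in fastforce)+

text \<open>
  Coverings are easier to combine than partitions, and \<open>union_queue_number_le\<close> shows
  that for the natural vertex ordering nothing is lost by passing to them.
\<close>

definition coverable :: "nat \<Rightarrow> nat set set \<Rightarrow> bool" where
  "coverable m F \<longleftrightarrow> (\<exists>U. (\<forall>i<m. union_queue less_than (U i)) \<and> F \<subseteq> (\<Union>i<m. U i))"

lemma coverable_mono: "coverable m F \<Longrightarrow> F' \<subseteq> F \<Longrightarrow> coverable m F'"
  unfolding coverable_def by (meson subset_trans)

lemma coverable_empty: "coverable 0 {}"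
  by (simp add: coverable_def)

lemma coverable_Un:
  assumes "coverable m F" "coverable m' F'"
  shows "coverable (m + m') (F \<union> F')"
proof -
  obtain U U' where U: "\<And>i. i < m \<Longrightarrow> union_queue less_than (U i)" "F \<subseteq> (\<Union>i<m. U i)"
    and U': "\<And>i. i < m' \<Longrightarrow> union_queue less_than (U' i)" "F' \<subseteq> (\<Union>i<m'. U' i)"
    using assms unfolding coverable_def by metis
  define W where "W i = (if i < m then U i else U' (i - m))" for i
  have "F \<subseteq> (\<Union>i<m + m'. W i)"
    using U(2) by (fastforce simp: W_def)
  moreover have "F' \<subseteq> (\<Union>i<m + m'. W i)"
  proof
    fix e assume "e \<in> F'"
    then obtain i where "i < m'" "e \<in> U' i" using U'(2) by blast
    then have "m + i < m + m'" "e \<in> W (m + i)" by (auto simp: W_def)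
    then show "e \<in> (\<Union>i<m + m'. W i)" by blast
  qed
  moreover have "union_queue less_than (W i)" if "i < m + m'" for i
    using that U(1) U'(1) by (auto simp: W_def)
  ultimately show ?thesis
    unfolding coverable_def by (intro exI[of _ W]) auto
qed

lemma coverable_UN_list:
  assumes "\<And>x. x \<in> set xs \<Longrightarrow> coverable m (F x)"
  shows "coverable (length xs * m) (\<Union>x\<in>set xs. F x)"
  using assms
proof (induction xs)
  case (Cons x xs)
  have "coverable (m + length xs * m) (F x \<union> (\<Union>x\<in>set xs. F x))"
    using Cons by (intro coverable_Un) auto
  then show ?case by simp
qed (simp add: coverable_empty)

text \<open>
  An edge {p a, q a} meets another edge of the family only if p of the other index is q a or q of
  the other index is p a. So it has at most two neighbours and a greedy colouring needs three
  colours.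
\<close>

lemma matching_colouring:
  assumes "finite D" "inj_on p D" "inj_on q D"
  shows "\<exists>col :: 'a \<Rightarrow> nat. (\<forall>a\<in>D. col a < 3) \<and>
    (\<forall>a\<in>D. \<forall>a'\<in>D. a \<noteq> a' \<longrightarrow> col a = col a' \<longrightarrow> {p a, q a} \<inter> {p a', q a'} = {})"
  using assms
proof (induction D)
  case (insert a D)
  obtain col :: "'a \<Rightarrow> nat" where col: "\<And>b. b \<in> D \<Longrightarrow> col b < 3"
    "\<And>b b'. b \<in> D \<Longrightarrow> b' \<in> D \<Longrightarrow> b \<noteq> b' \<Longrightarrow> col b = col b' \<Longrightarrow> {p b, q b} \<inter> {p b', q b'} = {}"
    using insert by (metis inj_on_insert)
  define X where "X = {b \<in> D. p b = q a} \<union> {b \<in> D. q b = p a}"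
  have "card {b \<in> D. p b = q a} \<le> 1" "card {b \<in> D. q b = p a} \<le> 1"
    using insert(1,4,5) by (auto simp: card_le_Suc0_iff_eq inj_on_def)
  then have "card X \<le> 2"
    unfolding X_def using card_Un_le[of "{b \<in> D. p b = q a}" "{b \<in> D. q b = p a}"] by linarith
  moreover have "finite X" using insert(1) by (simp add: X_def)
  ultimately have "card (col ` X) \<le> 2"
    by (meson card_image_le le_trans)
  have "\<not> {..<3} \<subseteq> col ` X"
  proof
    assume "{..<3} \<subseteq> col ` X"
    then have "card {..<3::nat} \<le> card (col ` X)" using \<open>finite X\<close> by (intro card_mono) auto
    then show False using \<open>card (col ` X) \<le> 2\<close> by simp
  qed
  then obtain i where i: "i < 3" "i \<notin> col ` X" by auto
  have new: "{p a, q a} \<inter> {p b, q b} = {}" if "b \<in> D" "col b = i" for b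
  proof -
    have "b \<notin> X" using that i(2) by blast
    moreover have "p b \<noteq> p a" "q b \<noteq> q a"
      using insert(2,4,5) that(1) by (auto simp: inj_on_def)
    ultimately show ?thesis using that(1) by (auto simp: X_def)
  qed
  show ?case
  proof (intro exI[of _ "col(a := i)"] conjI ballI impI)
    show "(col(a := i)) b < 3" if "b \<in> insert a D" for b
      using that col(1) i(1) by auto
    show "{p b, q b} \<inter> {p b', q b'} = {}"
      if "b \<in> insert a D" "b' \<in> insert a D" "b \<noteq> b'" "(col(a := i)) b = (col(a := i)) b'" for b b'
      using that new[of b] new[of b'] col(2)[of b b'] by (auto split: if_splits)
  qed
qed simp

lemma coverable_injective_family:
  assumes "finite D" "inj_on p D" "inj_on q D"
  shows "coverable 3 ((\<lambda>a. {p a, q a}) ` D)"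
proof -
  obtain col :: "'a \<Rightarrow> nat" where col: "\<And>a. a \<in> D \<Longrightarrow> col a < 3"
    "\<And>a a'. a \<in> D \<Longrightarrow> a' \<in> D \<Longrightarrow> a \<noteq> a' \<Longrightarrow> col a = col a' \<Longrightarrow> {p a, q a} \<inter> {p a', q a'} = {}"
    using matching_colouring[OF assms] by blast
  define U where "U i = (\<lambda>a. {p a, q a}) ` {a \<in> D. col a = i}" for i
  have "union_queue less_than (U i)" for i
  proof (rule union_queue_matching)
    fix e f assume ef: "e \<in> U i" "f \<in> U i" "e \<noteq> f"
    obtain a where a: "a \<in> D" "col a = i" "e = {p a, q a}" using ef(1) unfolding U_def by blast
    obtain a' where a': "a' \<in> D" "col a' = i" "f = {p a', q a'}" using ef(2) unfolding U_def by blast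
    have "a \<noteq> a'" "col a = col a'" using ef(3) a a' by auto
    then show "e \<inter> f = {}" unfolding a(3) a'(3) by (rule col(2)[OF a(1) a'(1)])
  qed
  moreover have "(\<lambda>a. {p a, q a}) ` D \<subseteq> (\<Union>i<3. U i)"
    using col(1) by (force simp: U_def)
  ultimately show ?thesis unfolding coverable_def by blast
qed

text \<open>
  The form in which lost edges are handled: p and q range over finite lists of injective
  functions, and for the index a only those pairs of values count that are natural numbers.
  Integer values allow affine functions with negative slope or with values outside of the vertex
  set.
\<close>

lemma coverable_injective_families:
  fixes ps qs :: "('a \<Rightarrow> int) list"
  assumes D: "finite D" and inj: "\<And>f. f \<in> set ps \<union> set qs \<Longrightarrow> inj_on f D"
    and F: "\<And>e. e \<in> F \<Longrightarrow> \<exists>a\<in>D. \<exists>p\<in>set ps. \<exists>q\<in>set qs. \<exists>x y. e = {x, y} \<and> p a = int x \<and> q a = int y"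
  shows "coverable (length ps * (length qs * 3)) F"
proof -
  define G where "G p q = (\<lambda>a. {nat (p a), nat (q a)}) ` {a \<in> D. 0 \<le> p a \<and> 0 \<le> q a}"
    for p q :: "'a \<Rightarrow> int"
  have inj': "inj_on (\<lambda>a. nat (f a)) {a \<in> D. 0 \<le> p a \<and> 0 \<le> q a}"
    if "f \<in> set ps \<union> set qs" "f = p \<or> f = q" for f p q
    using inj[OF that(1)] that(2) by (auto simp: inj_on_def)
  have "coverable 3 (G p q)" if "p \<in> set ps" "q \<in> set qs" for p q
    unfolding G_def using D that by (intro coverable_injective_family inj') auto
  then have "coverable (length ps * (length qs * 3)) (\<Union>p\<in>set ps. \<Union>q\<in>set qs. G p q)"
    by (intro coverable_UN_list) auto
  moreover have "F \<subseteq> (\<Union>p\<in>set ps. \<Union>q\<in>set qs. G p q)"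
  proof
    fix e assume "e \<in> F"
    then obtain a p q x y where *: "a \<in> D" "p \<in> set ps" "q \<in> set qs" "e = {x, y}"
      "p a = int x" "q a = int y"
      using F by meson
    then have "e = {nat (p a), nat (q a)}" "a \<in> {a \<in> D. 0 \<le> p a \<and> 0 \<le> q a}" by auto
    then have "e \<in> G p q" unfolding G_def by blast
    with * show "e \<in> (\<Union>p\<in>set ps. \<Union>q\<in>set qs. G p q)" by blast
  qed
  ultimately show ?thesis by (rule coverable_mono)
qed

text \<open>
  An edge is assigned to the first union queue of the cover that contains it.
\<close>

lemma union_queue_number_le:
  assumes "coverable m (complete_edges n)"
  shows "union_queue_number {..<n} (complete_edges n) \<le> m"
proof -
  obtain U where U: "\<And>i. i < m \<Longrightarrow> union_queue less_than (U i)"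
    "complete_edges n \<subseteq> (\<Union>i<m. U i)"
    using assms unfolding coverable_def by blast
  define W where "W i = (U i \<inter> complete_edges n) - (\<Union>j<i. U j)" for i
  define P where "P = W ` {..<m} - {{}}"
  have part: "partition_on (complete_edges n) P"
  proof (rule partition_onI)
    show "\<Union>P = complete_edges n"
    proof (intro equalityI subsetI)
      fix e assume e: "e \<in> complete_edges n"
      define i where "i = (LEAST i. e \<in> U i)"
      obtain j where "j < m" "e \<in> U j" using e U(2) by blast
      then have "e \<in> U i" "i \<le> j" unfolding i_def by (auto intro: LeastI Least_le)
      moreover have "e \<notin> U l" if "l < i" for l using that not_less_Least i_def by blast
      ultimately have "e \<in> W i" "i < m" using e \<open>j < m\<close> by (auto simp: W_def)
      then show "e \<in> \<Union>P" by (auto simp: P_def)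
    qed (auto simp: P_def W_def)
    show "disjnt p q" if pq: "p \<in> P" "q \<in> P" "p \<noteq> q" for p q
    proof -
      obtain i j where "p = W i" "q = W j" "i \<noteq> j" using pq unfolding P_def by blast
      then show ?thesis by (cases "i < j") (auto simp: W_def disjnt_def)
    qed
  qed (auto simp: P_def)
  have "strict_linear_order_on {..<n} less_than"
    by (auto simp: strict_linear_order_on_def total_on_def irrefl_def)
  moreover have "union_queue less_than Q" if "Q \<in> P" for Q
  proof -
    obtain i where "i < m" "Q = W i" using \<open>Q \<in> P\<close> by (auto simp: P_def)
    then show ?thesis using union_queue_subset[OF U(1)[of i], of "W i"] by (auto simp: W_def)
  qed
  moreover have "card P \<le> m"
  proof -
    have "card P \<le> card (W ` {..<m})" unfolding P_def by (intro card_mono) auto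
    also have "\<dots> \<le> card {..<m}" by (rule card_image_le) simp
    finally show ?thesis by simp
  qed
  ultimately have "\<exists>r P. union_queue_layout {..<n} (complete_edges n) r P \<and> card P \<le> m"
    using part unfolding union_queue_layout_def linear_layout_def by blast
  then show ?thesis unfolding union_queue_number_def by (rule Least_le)
qed

text \<open>
  The queues of one union queue are vertex-disjoint, so a vertex meets at most one of them.
\<close>

lemma local_queue_number_le_union_queue_number:
  assumes G: "simple_graph V E"
  shows "local_queue_number V E \<le> union_queue_number V E"
proof -
  obtain r P where P: "union_queue_layout V E r P" "card P \<le> union_queue_number V E"
    using union_queue_number_attained[OF G] by blast
  have part: "partition_on E P" and ord: "strict_linear_order_on V r"
    using P(1) by (auto simp: union_queue_layout_def linear_layout_def)
  have "finite P" using finite_edge_partition[OF G] P(1) by (auto simp: union_queue_layout_def)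
  have "\<forall>U\<in>P. \<exists>\<Q>. U = \<Union>\<Q> \<and> (\<forall>Q\<in>\<Q>. queue r Q) \<and>
     (\<forall>Q\<in>\<Q>. \<forall>Q'\<in>\<Q>. Q \<noteq> Q' \<longrightarrow> \<Union>Q \<inter> \<Union>Q' = {})"
    using P(1) by (auto simp: union_queue_layout_def union_queue_def)
  then obtain \<Q> where Q: "\<And>U. U \<in> P \<Longrightarrow> U = \<Union>(\<Q> U)"
    "\<And>U Q. U \<in> P \<Longrightarrow> Q \<in> \<Q> U \<Longrightarrow> queue r Q"
    "\<And>U Q Q'. U \<in> P \<Longrightarrow> Q \<in> \<Q> U \<Longrightarrow> Q' \<in> \<Q> U \<Longrightarrow> Q \<noteq> Q' \<Longrightarrow> \<Union>Q \<inter> \<Union>Q' = {}"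
    by metis
  define P' where "P' = (\<Union>U\<in>P. \<Q> U) - {{}}"
  have nonempty: "e \<noteq> {}" if "U \<in> P" "e \<in> U" for e U
  proof -
    have "e \<in> [V]\<^bsup>2\<^esup>" using that part G by (auto simp: partition_on_def simple_graph_def)
    then show ?thesis by (auto simp: nsets_def)
  qed
  have "partition_on E P'"
  proof (rule partition_onI)
    have "E = \<Union>P" using part by (simp add: partition_on_def)
    also have "\<dots> = \<Union>(\<Union>U\<in>P. \<Q> U)" using Q(1) by blast
    also have "\<dots> = \<Union>P'" unfolding P'_def by blast
    finally show "\<Union>P' = E" by simp
    show "disjnt p q" if p: "p \<in> P'" and q: "q \<in> P'" and "p \<noteq> q" for p q
    proof (rule ccontr)
      assume "\<not> disjnt p q"
      then obtain e where e: "e \<in> p" "e \<in> q" by (auto simp: disjnt_def)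
      obtain U U' where U: "U \<in> P" "p \<in> \<Q> U" "U' \<in> P" "q \<in> \<Q> U'"
        using p q by (auto simp: P'_def)
      then have eU: "e \<in> U" "e \<in> U'" using e Q(1) by blast+
      then have "U = U'" using part U by (auto simp: partition_on_def disjoint_def)
      then have "\<Union>p \<inter> \<Union>q = {}" using Q(3) U \<open>p \<noteq> q\<close> by metis
      then show False using e nonempty[OF U(1) eU(1)] by blast
    qed
  qed (auto simp: P'_def)
  moreover have "queue r Q" if "Q \<in> P'" for Q
    using that Q(2) by (auto simp: P'_def)
  ultimately have layout: "queue_layout V E r P'"
    using ord by (auto simp: queue_layout_def linear_layout_def)
  have "card {Q \<in> P'. v \<in> \<Union>Q} \<le> union_queue_number V E" for v
  proof -
    have "\<forall>Q\<in>P'. \<exists>U. U \<in> P \<and> Q \<in> \<Q> U" by (auto simp: P'_def)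
    then obtain u where u: "\<And>Q. Q \<in> P' \<Longrightarrow> u Q \<in> P \<and> Q \<in> \<Q> (u Q)" by metis
    have "inj_on u {Q \<in> P'. v \<in> \<Union>Q}"
    proof (rule inj_onI)
      fix Q Q' assume *: "Q \<in> {Q \<in> P'. v \<in> \<Union>Q}" "Q' \<in> {Q \<in> P'. v \<in> \<Union>Q}" "u Q = u Q'"
      then have "v \<in> \<Union>Q \<inter> \<Union>Q'" by blast
      then show "Q = Q'" using * u[of Q] u[of Q'] Q(3)[of "u Q" Q Q'] by auto
    qed
    then have "card {Q \<in> P'. v \<in> \<Union>Q} \<le> card P"
      using u \<open>finite P\<close> by (intro card_inj_on_le[of u]) auto
    then show ?thesis using P(2) by simp
  qed
  then have "local_layout (union_queue_number V E) V P'" by (simp add: local_layout_def)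
  then show ?thesis
    unfolding local_queue_number_def using layout by (intro Least_le) blast
qed

section \<open>Nested paths together with mirrored stars\<close>

definition mirror :: "nat \<Rightarrow> nat \<Rightarrow> nat" where
  "mirror N v = N - 1 - v"

text \<open>
  The staircase path on the vertices a, ..., N - 1 - a. With 2(k - a) as the larger of the two
  differences on the staircase, the paths for a < k use up the differences 1, ..., 2k in pairs.
\<close>

definition main_path :: "nat \<Rightarrow> nat \<Rightarrow> nat \<Rightarrow> nat set set" where
  "main_path N k a = {{x, y} | x y. a \<le> x \<and> x < y \<and> y \<le> N - 1 - a \<and> y \<le> x + 2 * (k - a) \<and>
     (x + 2 * (k - a) \<le> y + 1 \<or> x = a \<or> y = N - 1 - a)}"

lemma nest_less_than_iff:
  assumes "x < y" "x' < y'"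
  shows "nest less_than {x, y} {x', y'} \<longleftrightarrow> x < x' \<and> y' < y \<or> x' < x \<and> y < (y' :: nat)"
proof
  assume "nest less_than {x, y} {x', y'}"
  then obtain v w v' w' where *: "{x, y} = {v, w}" "{x', y'} = {v', w'}" "v < w" "v' < w'"
    "v < v' \<and> w' < w \<or> v' < v \<and> w < w'"
    unfolding nest_def by auto
  then have "v = x" "w = y" "v' = x'" "w' = y'" using assms by (auto simp: doubleton_eq_iff)
  then show "x < x' \<and> y' < y \<or> x' < x \<and> y < y'" using *(5) by simp
next
  assume *: "x < x' \<and> y' < y \<or> x' < x \<and> y < y'"
  have "{x, y} \<inter> {x', y'} = {}" using * assms by auto
  then show "nest less_than {x, y} {x', y'}"
    unfolding nest_def less_than_iff using * assms by blast
qed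

text \<open>
  An edge strictly inside an edge {x, y} of the path is shorter by at least two, hence lies
  strictly below the staircase; it would have to use the first or the last vertex of the path.
\<close>

lemma main_path_non_nesting:
  assumes "e \<in> main_path N k a" "f \<in> main_path N k a"
  shows "\<not> nest less_than e f"
proof -
  obtain x y where e: "e = {x, y}" "a \<le> x" "x < y" "y \<le> N - 1 - a" "y \<le> x + 2 * (k - a)"
    "x + 2 * (k - a) \<le> y + 1 \<or> x = a \<or> y = N - 1 - a"
    using assms(1) unfolding main_path_def by blast
  obtain x' y' where f: "f = {x', y'}" "a \<le> x'" "x' < y'" "y' \<le> N - 1 - a" "y' \<le> x' + 2 * (k - a)"
    "x' + 2 * (k - a) \<le> y' + 1 \<or> x' = a \<or> y' = N - 1 - a"
    using assms(2) unfolding main_path_def by blast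
  show ?thesis
    unfolding e(1) f(1) nest_less_than_iff[OF e(3) f(3)] using e(2-) f(2-) by linarith
qed

text \<open>
  The index is determined by the difference y - x, unless an end of the edge lies outside of that
  path. Then the outer end itself, or its mirror image, is the index of a path that contains the
  edge in its initial column or its final row.
\<close>

lemma main_path_covers_short_edges:
  assumes "x < y" "y < N" "y \<le> x + 2 * k" "2 * k \<le> N"
  shows "\<exists>a<k. {x, y} \<in> main_path N k a"
proof -
  define h where "h = (y - x + 1) div 2"
  have h: "y \<le> x + 2 * h" "x + 2 * h \<le> y + 1" "h \<le> k" "0 < h"
    using assms unfolding h_def by linarith+
  define a where "a = (if x < k - h then x else if N - 1 - y < k - h then N - 1 - y else k - h)"
  have "a < k" using h assms by (auto simp: a_def)
  moreover have "a \<le> x \<and> x < y \<and> y \<le> N - 1 - a \<and> y \<le> x + 2 * (k - a) \<and>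
     (x + 2 * (k - a) \<le> y + 1 \<or> x = a \<or> y = N - 1 - a)"
    using h assms unfolding a_def by (auto split: if_splits)
  ultimately show ?thesis unfolding main_path_def by blast
qed

text \<open>
  The edges with index a for a set Z of centers and a schedule c. The set Z is meant to be small.
  The stars come in mirrored pairs: a leaf x of the center c x gives the edge from x to the mirror
  image of c x and the mirrored edge. Leaves in Z are dropped, and so are the path edges that meet
  Z or its mirror image, because a center must not occur in any other part of the union queue.
\<close>

definition main_and_star_layer :: "nat \<Rightarrow> nat \<Rightarrow> nat \<Rightarrow> nat set \<Rightarrow> (nat \<Rightarrow> nat) \<Rightarrow> nat set set" where
  "main_and_star_layer N k a Z c = {e \<in> main_path N k a. e \<inter> (Z \<union> mirror N ` Z) = {}} \<union>
     (\<Union>x\<in>{x. x < a \<and> x \<notin> Z \<and> c x \<in> Z}. {{x, mirror N (c x)}, {c x, mirror N x}})"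

text \<open>
  Vertices below H and mirror images of such vertices are different, as 2H \<le> N. Each star is
  labelled by its center and the path by N, which is not a vertex.
\<close>

lemma union_queue_main_and_star_layer:
  assumes Z: "Z \<subseteq> {..<H}" and H: "a \<le> H" "2 * H \<le> N"
  shows "union_queue less_than (main_and_star_layer N k a Z c)"
proof -
  define lab where "lab v = (if v \<in> Z \<union> mirror N ` Z then v else if v < a then mirror N (c v)
      else if mirror N v < a then c (mirror N v) else N)" for v
  have low: "v \<notin> mirror N ` Z" if "v < H" for v
    using that Z H by (auto simp: mirror_def)
  have high: "mirror N v \<notin> Z" "\<not> mirror N v < a" "mirror N (mirror N v) = v" if "v < H" for v
    using that Z H by (auto simp: mirror_def)
  have main: "lab v = N" if "v \<in> e" "e \<in> main_path N k a" "e \<inter> (Z \<union> mirror N ` Z) = {}" for v e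
  proof -
    have "a \<le> v" "v \<le> N - 1 - a" using that(1,2) unfolding main_path_def by auto
    moreover have "v \<notin> Z \<union> mirror N ` Z" using that by blast
    ultimately show ?thesis using H by (auto simp: lab_def mirror_def)
  qed
  have star: "lab x = mirror N (c x)" "lab (mirror N x) = c x"
    "lab (c x) = c x" "lab (mirror N (c x)) = mirror N (c x)"
    "c x < N" "mirror N (c x) < N"
    if "x < a" "x \<notin> Z" "c x \<in> Z" for x
  proof -
    have "x < H" using that(1) H by simp
    have "mirror N x \<notin> mirror N ` Z"
    proof
      assume "mirror N x \<in> mirror N ` Z"
      then obtain z where "z \<in> Z" "mirror N x = mirror N z" by blast
      then have "x = z" using \<open>x < H\<close> Z H by (auto simp: mirror_def subset_eq)
      then show False using \<open>z \<in> Z\<close> that(2) by simp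
    qed
    then show "lab x = mirror N (c x)" "lab (mirror N x) = c x"
      using that low[OF \<open>x < H\<close>] high[OF \<open>x < H\<close>] by (auto simp: lab_def)
    show "lab (c x) = c x" "lab (mirror N (c x)) = mirror N (c x)"
      using that by (auto simp: lab_def)
    show "c x < N" "mirror N (c x) < N" using that Z H by (auto simp: mirror_def)
  qed
  have dichotomy: "(e \<in> main_path N k a \<and> (\<forall>v\<in>e. lab v = N)) \<or> (\<exists>l\<in>e. l < N \<and> (\<forall>v\<in>e. lab v = l))"
    if "e \<in> main_and_star_layer N k a Z c" for e
  proof -
    have "(e \<in> main_path N k a \<and> e \<inter> (Z \<union> mirror N ` Z) = {}) \<or>
        (\<exists>x. x < a \<and> x \<notin> Z \<and> c x \<in> Z \<and> (e = {x, mirror N (c x)} \<or> e = {c x, mirror N x}))"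
      using that unfolding main_and_star_layer_def by blast
    then show ?thesis using main star by (elim disjE exE conjE) auto
  qed
  show ?thesis
  proof (rule union_queue_if_labelled[where lab = lab])
    show "lab v = lab w" if "e \<in> main_and_star_layer N k a Z c" "v \<in> e" "w \<in> e" for e v w
      using dichotomy[OF that(1)] that(2,3) by metis
    show "\<not> nest less_than e f"
      if "e \<in> main_and_star_layer N k a Z c" "f \<in> main_and_star_layer N k a Z c"
        "v \<in> e" "w \<in> f" "lab v = lab w" for e f v w
    proof (cases "lab v = N")
      case True
      then have "e \<in> main_path N k a" "f \<in> main_path N k a"
        using dichotomy[OF that(1)] dichotomy[OF that(2)] that(3-5) by (metis less_irrefl)+
      then show ?thesis by (rule main_path_non_nesting)
    next
      case False
      then have "lab v \<in> e" "lab v \<in> f"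
        using dichotomy[OF that(1)] dichotomy[OF that(2)] that(3-5) by metis+
      then have "e \<inter> f \<noteq> {}" by blast
      then show ?thesis by (simp add: nest_def)
    qed
  qed
qed

section \<open>A schedule of star centers\<close>

text \<open>
  The center at index a for the leaf x, where x < a. The numbers below 4m + 2b are divided into
  the blocks A = [0, 2m), B = [2m, 2m + b), B' = [2m + b, 2m + 2b) and C = [2m + 2b, 4m + 2b). A
  pair with sum below 4m + 2b is of one of the following kinds, and is scheduled as indicated.

  \<^item> A and C: the index a \<le> 2m has the single center 4m + 2b - a in C for all its
  leaves.

  \<^item> A and B': the index 2m + 1 + j with j < b has the center 2m + b + j in B' for the
  leaves in A.

  \<^item> Inside B: the same index has its predecessor 2m + j in B as the center for the smaller
  elements of B.

  \<^item> B and B': the index 2m + b + 1 + j with j < b has the center 2m + b - 1 - j in B for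
  the leaves in B'.

  \<^item> Inside A: for j < m, this index has the two centers j and j + m. The leaves of j + m
  are the m elements of A that precede it, and those of j are the others, which makes A an almost
  regular tournament.

  \<^item> A and B: this is where the remaining slots go, namely the b indices 2m + b + 1 + j for
  leaves in B, and those of them with j \<ge> m for leaves in A. So an element of B can be a leaf
  of b elements of A, and an element x of A has to be a leaf of the b - m elements of B of which
  it is not a center. The slots of the leaves in B are enumerated as j b + y, for the leaf 2m + y,
  and are cut into intervals of length m: the interval with number x goes to the center x. Since
  there are b^2 \<ge> 2m^2 slots, every x in A gets its full interval. As an interval winds around
  modulo b, the leaves of x are s, ..., s + m - 1 modulo b with s = x m mod b. The other elements
  are represented by the numbers s + m, ..., s + b - 1. These are b - m consecutive numbers, so
  exactly one of them is congruent to j - m modulo b - m, and this one is the center of x at the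
  index with parameter j. In this way only boundedly many centers are in use at each index.
\<close>

definition center :: "nat \<Rightarrow> nat \<Rightarrow> nat \<Rightarrow> nat \<Rightarrow> nat" where
  "center m b a x =
    (if a \<le> 2 * m then 4 * m + 2 * b - a
     else if a \<le> 2 * m + b then (if x < 2 * m then a + b - 1 else a - 1)
     else let j = a - (2 * m + b + 1) in
       if x < 2 * m then
         (if j < m then (if j \<le> x \<and> x < j + m then j + m else j)
          else let s = x * m mod b + m in
            2 * m + (s + nat ((int j - int m - int s) mod int (b - m))) mod b)
       else if x < 2 * m + b then (j * b + (x - 2 * m)) div m
       else 2 * m + b - 1 - j)"

text \<open>
  All possible centers at the index 2m + b + 1 + j as functions of j. The fourth family contains
  the numbers of the intervals that meet the row j of slots, and the fifth contains the residues
  modulo b of the numbers below 2b that are congruent to j - m modulo b - m; the shift by b - m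
  avoids a negative value of j - m. Eight values of t suffice because of b \<le> 4(b - m).
\<close>

definition center_maps :: "nat \<Rightarrow> nat \<Rightarrow> (nat \<Rightarrow> nat) list" where
  "center_maps m b = [\<lambda>j. j, \<lambda>j. j + m, \<lambda>j. 2 * m + b - 1 - j] @
     map (\<lambda>i j. j * b div m + i) [0..<4] @
     map (\<lambda>t j. 2 * m + (j + (t + 1) * (b - m)) mod b) [0..<8]"

text \<open>
  For a > 2m + b, the restriction to numbers below a keeps the centers away from the path with
  index a, so that such a path loses no edges. At a = 0 there is no leaf, and the path stays
  complete.
\<close>

definition centers :: "nat \<Rightarrow> nat \<Rightarrow> nat \<Rightarrow> nat set" where
  "centers m b a =
    (if a = 0 then {}
     else if a \<le> 2 * m then {4 * m + 2 * b - a}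
     else if a \<le> 2 * m + b then {a + b - 1, a - 1}
     else (\<lambda>f. f (a - (2 * m + b + 1))) ` set (center_maps m b) \<inter> {..<a})"

lemma less_if_double_square_le:
  fixes m b :: nat
  assumes "0 < m" "2 * m * m \<le> b * b"
  shows "m < b"
proof (rule ccontr)
  assume "\<not> m < b"
  then have "b * b \<le> m * m" by (intro mult_mono) auto
  moreover have "0 < m * m" using assms(1) by simp
  ultimately show False using assms(2) by (simp add: mult.assoc)
qed

text \<open>
  The rotation between A and B. Let d be the distance from the starting residue s of x forward to
  y modulo b. If d < m, then y is a leaf in the interval of x, otherwise s + d is one of the b - m
  consecutive numbers that represent the centers of x.
\<close>

lemma center_exists_two_blocks:
  assumes m: "0 < m" "2 * m * m \<le> b * b" "b \<le> 2 * m" and x: "x < 2 * m" and y: "y < b"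
  shows "\<exists>a. 2 * m + b < a \<and> a \<le> 2 * m + 2 * b \<and>
    (center m b a (2 * m + y) = x \<and> x \<in> centers m b a \<or>
     center m b a x = 2 * m + y \<and> 2 * m + y \<in> centers m b a)"
proof -
  have "m < b" using less_if_double_square_le[OF m(1,2)] .
  define g where "g = b - m"
  have g: "0 < g" "b = m + g" using \<open>m < b\<close> by (auto simp: g_def)
  have "b \<le> 4 * g"
  proof (rule ccontr)
    assume "\<not> b \<le> 4 * g"
    then have "3 * b < 4 * m" using g(2) by linarith
    from mult_strict_mono[OF this this] have "(3 * b) * (3 * b) < (4 * m) * (4 * m)"
      using m(1) by simp
    then show False using m(1,2) by (simp add: mult.assoc)
  qed
  define s where "s = x * m mod b"
  have "s < b" using \<open>m < b\<close> by (simp add: s_def)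
  define d where "d = (y + b - s) mod b"
  have "d < b" using \<open>m < b\<close> by (simp add: d_def)
  have sd: "(s + d) mod b = y"
  proof -
    have "(s + d) mod b = (s + (y + b - s)) mod b" unfolding d_def by (simp add: mod_add_right_eq)
    also have "\<dots> = y" using \<open>s < b\<close> y by simp
    finally show ?thesis .
  qed
  show ?thesis
  proof (cases "d < m")
    case True
    define t where "t = x * m + d"
    define j where "j = t div b"
    have tb: "t mod b = y"
    proof -
      have "t mod b = (s + d) mod b" unfolding t_def s_def by (simp add: mod_add_left_eq)
      then show ?thesis using sd by simp
    qed
    \<comment> \<open>This is the place where there have to be enough slots for all intervals.\<close>
    have "t < b * b"
    proof -
      have "t < (x + 1) * m" using True by (simp add: t_def algebra_simps)
      also have "\<dots> \<le> 2 * m * m" using x by (intro mult_right_mono) auto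
      finally show ?thesis using m(2) by linarith
    qed
    then have "j < b" by (simp add: j_def less_mult_imp_div_less)
    have jby: "j * b + y = t" using tb by (simp add: j_def flip: tb)
    have "t div m = x" using True m(1) by (simp add: t_def)
    define a where "a = 2 * m + b + 1 + j"
    have "center m b a (2 * m + y) = x"
      using y jby \<open>t div m = x\<close> by (simp add: center_def a_def)
    moreover have "x \<in> centers m b a"
    proof -
      define i where "i = x - j * b div m"
      have "j * b div m \<le> x" using \<open>t div m = x\<close> jby by (metis div_le_mono le_add1)
      moreover have "x \<le> j * b div m + 3"
      proof -
        have "x \<le> (j * b + 2 * m) div m"
          unfolding \<open>t div m = x\<close>[symmetric] jby[symmetric] using y m(3) by (intro div_le_mono) simp
        also have "\<dots> = j * b div m + 2" using m(1) by simp
        finally show ?thesis by simp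
      qed
      ultimately have i: "x = j * b div m + i" "i < 4" unfolding i_def by auto
      have "(\<lambda>j. j * b div m + i) \<in> set (center_maps m b)"
        using i(2) by (auto simp: center_maps_def)
      moreover have "a - (2 * m + b + 1) = j" by (simp add: a_def)
      ultimately have "x \<in> (\<lambda>f. f (a - (2 * m + b + 1))) ` set (center_maps m b)"
        using i(1) by (metis (no_types, lifting) image_eqI)
      then show ?thesis using x by (auto simp: centers_def a_def)
    qed
    ultimately show ?thesis using \<open>j < b\<close> by (intro exI[of _ a]) (auto simp: a_def)
  next
    case False
    define t where "t = s + d"
    define r where "r = t mod g"
    define a where "a = 2 * m + b + 1 + (m + r)"
    have "r < g" using g(1) by (simp add: r_def)
    have "t = s + m + nat ((int (m + r) - int m - int (s + m)) mod int g)"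
    proof -
      have "(int (m + r) - int m - int (s + m)) mod int g = (int t - int (s + m)) mod int g"
        unfolding r_def by (simp add: of_nat_mod mod_diff_left_eq)
      also have "int t - int (s + m) = int (d - m)" using False by (simp add: t_def)
      also have "int (d - m) mod int g = int (d - m)"
        using \<open>d < b\<close> g(2) False by (intro mod_pos_pos_trivial) auto
      finally show ?thesis using False by (simp add: t_def)
    qed
    then have "center m b a x = 2 * m + t mod b"
      using x by (simp add: center_def a_def Let_def s_def g_def)
    then have "center m b a x = 2 * m + y" using sd by (simp add: t_def)
    moreover have "2 * m + y \<in> centers m b a"
    proof -
      define i where "i = t div g"
      have t: "t = i * g + r" by (simp add: i_def r_def)
      have "i < 8"
      proof -
        have "t < 8 * g" using \<open>s < b\<close> \<open>d < b\<close> \<open>b \<le> 4 * g\<close> by (simp add: t_def)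
        then show ?thesis unfolding i_def by (simp add: less_mult_imp_div_less)
      qed
      have "((m + r) + (i + 1) * g) mod b = (t + b) mod b"
        unfolding t g(2) by (simp add: algebra_simps)
      also have "\<dots> = y" using sd by (simp add: t_def)
      finally have eq: "2 * m + y = 2 * m + ((m + r) + (i + 1) * (b - m)) mod b"
        unfolding g_def by simp
      have "(\<lambda>j. 2 * m + (j + (i + 1) * (b - m)) mod b) \<in> set (center_maps m b)"
        using \<open>i < 8\<close> by (auto simp: center_maps_def)
      moreover have "a - (2 * m + b + 1) = m + r" by (simp add: a_def)
      ultimately have "2 * m + y \<in> (\<lambda>f. f (a - (2 * m + b + 1))) ` set (center_maps m b)"
        using eq by (metis (no_types, lifting) image_eqI)
      then show ?thesis using y by (auto simp: centers_def a_def)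
    qed
    ultimately show ?thesis using \<open>r < g\<close> g(2) by (intro exI[of _ a]) (auto simp: a_def)
  qed
qed

text \<open>
  The case distinction follows the blocks that contain the two elements; the condition on the sum
  leaves only A as a partner of C, and A and B as partners of B'.
\<close>

lemma center_exists:
  assumes m: "0 < m" "2 * m * m \<le> b * b" "b \<le> 2 * m" and xz: "x < z" "x + z < 4 * m + 2 * b"
  shows "\<exists>a\<le>2 * m + 2 * b. (x < a \<and> center m b a x = z \<and> z \<in> centers m b a) \<or>
    (z < a \<and> center m b a z = x \<and> x \<in> centers m b a)"
proof -
  have "m < b" using less_if_double_square_le[OF m(1,2)] .
  consider (C) "2 * m + 2 * b \<le> z"
    | (AB1) "2 * m + b \<le> z" "z < 2 * m + 2 * b" "x < 2 * m"
    | (BB1) "2 * m + b \<le> z" "z < 2 * m + 2 * b" "2 * m \<le> x" "x < 2 * m + b"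
    | (AB0) "2 * m \<le> z" "z < 2 * m + b" "x < 2 * m"
    | (BB0) "2 * m \<le> z" "z < 2 * m + b" "2 * m \<le> x"
    | (A) "z < 2 * m"
    using xz by linarith
  then show ?thesis
  proof cases
    case C
    then show ?thesis
      using xz by (intro exI[of _ "4 * m + 2 * b - z"]) (auto simp: center_def centers_def)
  next
    case AB1
    then show ?thesis
      using xz by (intro exI[of _ "z + 1 - b"]) (auto simp: center_def centers_def)
  next
    case BB1
    define j where "j = 2 * m + b - 1 - x"
    have j: "j < b" "x = 2 * m + b - 1 - j" "z \<le> 2 * m + b + j"
      using BB1 xz by (auto simp: j_def)
    define a where "a = 2 * m + b + 1 + j"
    have "center m b a z = x" using BB1 j(2) by (simp add: center_def a_def Let_def)
    moreover have "x \<in> centers m b a"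
      using BB1 j by (auto simp: centers_def a_def center_maps_def)
    ultimately show ?thesis using j by (intro exI[of _ a]) (auto simp: a_def)
  next
    case AB0
    then obtain a where "2 * m + b < a" "a \<le> 2 * m + 2 * b"
      "center m b a z = x \<and> x \<in> centers m b a \<or> center m b a x = z \<and> z \<in> centers m b a"
      using center_exists_two_blocks[OF m, of x "z - 2 * m"] by (auto simp: less_diff_conv2)
    then show ?thesis using AB0 by (intro exI[of _ a]) auto
  next
    case BB0
    then show ?thesis
      using xz by (intro exI[of _ "z + 1"]) (auto simp: center_def centers_def)
  next
    case A
    \<comment> \<open>Either z is an upper center j + m and x one of the m leaves before it, or the smaller center j is x or z.\<close>
    define j where "j = (if m \<le> z \<and> z - m \<le> x then z - m else if m \<le> z then x else z)"
    define a where "a = 2 * m + b + 1 + j"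
    have j: "j < m" using A xz by (auto simp: j_def)
    have "j \<in> centers m b a" "j + m \<in> centers m b a"
      using j by (auto simp: centers_def a_def center_maps_def)
    moreover have "center m b a v = (if j \<le> v \<and> v < j + m then j + m else j)" if "v < 2 * m" for v
      using that j by (simp add: center_def a_def Let_def)
    ultimately show ?thesis
      using A xz j \<open>m < b\<close> by (intro exI[of _ a]) (auto simp: j_def a_def split: if_splits)
  qed
qed

text \<open>
  For the interval numbers, j b grows by b \<ge> m in each step, hence the quotient by m grows.
\<close>

lemma inj_on_center_maps:
  assumes "0 < m" "m \<le> b" "f \<in> set (center_maps m b)"
  shows "inj_on f {..<b}"
proof -
  have div: "inj_on (\<lambda>j. j * b div m + i) {..<b}" for i
  proof -
    have "j * b div m + i < j' * b div m + i" if "j < j'" for j j'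
    proof -
      have "j * b + m \<le> (j + 1) * b" using assms(2) by (simp add: algebra_simps)
      also have "\<dots> \<le> j' * b" using that by (intro mult_right_mono) auto
      finally have "(j * b + m) div m \<le> j' * b div m" by (rule div_le_mono)
      then show ?thesis using assms(1) by simp
    qed
    then have "strict_mono (\<lambda>j. j * b div m + i)" by (intro strict_monoI) auto
    then show ?thesis using strict_mono_imp_inj_on inj_on_subset by blast
  qed
  have rot: "inj_on (\<lambda>j. c + (j + d) mod b) {..<b}" for c d
  proof (rule inj_onI)
    fix j j' assume *: "j \<in> {..<b}" "j' \<in> {..<b}" "c + (j + d) mod b = c + (j' + d) mod b"
    then have "(int j + int d) mod int b = (int j' + int d) mod int b"
      by (metis add_left_imp_eq of_nat_add of_nat_mod)
    then have "int j mod int b = int j' mod int b"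
      by (metis add_diff_cancel_right' mod_diff_left_eq)
    then show "j = j'" using * by simp
  qed
  consider "f = (\<lambda>j. j)" | "f = (\<lambda>j. j + m)" | "f = (\<lambda>j. 2 * m + b - 1 - j)"
    | i where "f = (\<lambda>j. j * b div m + i)"
    | t where "f = (\<lambda>j. 2 * m + (j + (t + 1) * (b - m)) mod b)"
    using assms(3) by (auto simp: center_maps_def)
  then show ?thesis
  proof cases
    case 4
    then show ?thesis using div by simp
  next
    case 5
    then show ?thesis using rot by simp
  qed (auto simp: inj_on_def)
qed

lemma length_center_maps: "length (center_maps m b) = 15"
  by (simp add: center_maps_def)

section \<open>Covering the complete graph\<close>

text \<open>
  Apart from the two ends of the path, a vertex v of the path with index a is joined to v
  \<plusminus> w and v \<plusminus> (w - 1) at most, where w = 2(k - a), and to the two ends a and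
  N - 1 - a. If v is affine in a with slope 1 or -1, or is the mirror image of such a vertex, then
  all these neighbours are affine in a with slope \<plusminus>1 or \<plusminus>3 and thus
  injective in a. There are two choices of v and ten possible neighbours.
\<close>

lemma coverable_lost_main_path_edges:
  fixes z :: "nat \<Rightarrow> nat" and c s :: int
  assumes D: "finite D" "\<And>a. a \<in> D \<Longrightarrow> a < z a \<and> z a + a + 1 < N \<and> a \<le> k"
    and z: "\<And>a. a \<in> D \<Longrightarrow> int (z a) = c + s * int a" and s: "s = 1 \<or> s = -1"
  shows "coverable 60 {e. \<exists>a\<in>D. e \<in> main_path N k a \<and> (z a \<in> e \<or> mirror N (z a) \<in> e)}"
proof -
  let ?z = "\<lambda>a. c + s * int a" and ?w = "\<lambda>a. 2 * (int k - int a)"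
  let ?ps = "[?z, \<lambda>a. int N - 1 - ?z a]"
  let ?qs = "[\<lambda>a. ?z a + ?w a, \<lambda>a. ?z a + ?w a - 1, \<lambda>a. ?z a - ?w a, \<lambda>a. ?z a - ?w a + 1,
    \<lambda>a. int N - 1 - ?z a + ?w a, \<lambda>a. int N - 1 - ?z a + ?w a - 1,
    \<lambda>a. int N - 1 - ?z a - ?w a, \<lambda>a. int N - 1 - ?z a - ?w a + 1,
    int, \<lambda>a. int N - 1 - int a]"
  have "coverable (length ?ps * (length ?qs * 3))
    {e. \<exists>a\<in>D. e \<in> main_path N k a \<and> (z a \<in> e \<or> mirror N (z a) \<in> e)}"
  proof (rule coverable_injective_families[OF D(1)])
    show "inj_on f D" if "f \<in> set ?ps \<union> set ?qs" for f
      using s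
    proof
      assume "s = 1"
      then show ?thesis using that by (auto simp: inj_on_def)
    next
      assume "s = -1"
      then show ?thesis using that by (auto simp: inj_on_def)
    qed
    fix e assume "e \<in> {e. \<exists>a\<in>D. e \<in> main_path N k a \<and> (z a \<in> e \<or> mirror N (z a) \<in> e)}"
    then obtain a where a: "a \<in> D" "e \<in> main_path N k a" "z a \<in> e \<or> mirror N (z a) \<in> e" by blast
    obtain x y where e: "e = {x, y}" "a \<le> x" "x < y" "y \<le> N - 1 - a" "y \<le> x + 2 * (k - a)"
      "x + 2 * (k - a) \<le> y + 1 \<or> x = a \<or> y = N - 1 - a"
      using a(2) unfolding main_path_def by blast
    have D': "a < z a" "z a + a + 1 < N" "a \<le> k" using D(2)[OF a(1)] by auto
    define \<zeta> \<omega> where "\<zeta> = ?z a" and "\<omega> = ?w a"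
    have \<omega>: "int (2 * (k - a)) = \<omega>" using D'(3) by (simp add: \<omega>_def of_nat_diff)
    have ixy: "int a \<le> int x" "int x < int y" "int y \<le> int N - 1 - int a" "int y \<le> int x + \<omega>"
      "int x + \<omega> \<le> int y + 1 \<or> int x = int a \<or> int y = int N - 1 - int a"
      using e(2-6) D'(2) \<omega> by linarith+
    have \<zeta>: "int (z a) = \<zeta>" "int (mirror N (z a)) = int N - 1 - \<zeta>"
      "int a < \<zeta>" "\<zeta> < int N - 1 - int a"
      using z[OF a(1), folded \<zeta>_def] D' by (auto simp: mirror_def)
    have "\<exists>u v. e = {u, v} \<and> (int u = \<zeta> \<or> int u = int N - 1 - \<zeta>) \<and>
      (int v = \<zeta> + \<omega> \<or> int v = \<zeta> + \<omega> - 1 \<or> int v = \<zeta> - \<omega> \<or> int v = \<zeta> - \<omega> + 1 \<or>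
       int v = int N - 1 - \<zeta> + \<omega> \<or> int v = int N - 1 - \<zeta> + \<omega> - 1 \<or>
       int v = int N - 1 - \<zeta> - \<omega> \<or> int v = int N - 1 - \<zeta> - \<omega> + 1 \<or>
       int v = int a \<or> int v = int N - 1 - int a)" (is "\<exists>u v. e = {u, v} \<and> ?P u \<and> ?R v")
    proof (cases "x = z a \<or> x = mirror N (z a)")
      case True
      then have "?P x" using \<zeta>(1,2) by metis
      moreover have "int y = int x + \<omega> \<or> int y = int x + \<omega> - 1 \<or> int y = int N - 1 - int a"
        using \<open>?P x\<close> ixy \<zeta>(3,4) by linarith
      with \<open>?P x\<close> have "?R y" by (elim disjE) simp_all
      ultimately show ?thesis using e(1) by blast
    next
      case False
      then have "y = z a \<or> y = mirror N (z a)" using a(3) e(1) by blast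
      then have "?P y" using \<zeta>(1,2) by metis
      moreover have "int x = int y - \<omega> \<or> int x = int y - \<omega> + 1 \<or> int x = int a"
        using \<open>?P y\<close> ixy \<zeta>(3,4) by linarith
      with \<open>?P y\<close> have "?R x" by (elim disjE) simp_all
      moreover have "e = {y, x}" using e(1) by (simp add: insert_commute)
      ultimately show ?thesis by blast
    qed
    then obtain u v where uv: "e = {u, v}" "int u = \<zeta> \<or> int u = int N - 1 - \<zeta>"
      "int v = \<zeta> + \<omega> \<or> int v = \<zeta> + \<omega> - 1 \<or> int v = \<zeta> - \<omega> \<or> int v = \<zeta> - \<omega> + 1 \<or>
       int v = int N - 1 - \<zeta> + \<omega> \<or> int v = int N - 1 - \<zeta> + \<omega> - 1 \<or>
       int v = int N - 1 - \<zeta> - \<omega> \<or> int v = int N - 1 - \<zeta> - \<omega> + 1 \<or>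
       int v = int a \<or> int v = int N - 1 - int a"
      by blast
    have "\<exists>p\<in>set ?ps. p a = int u"
      using uv(2) unfolding \<zeta>_def list.set bex_simps by (elim disjE) simp_all
    moreover have "\<exists>q\<in>set ?qs. q a = int v"
      using uv(3) unfolding \<zeta>_def \<omega>_def list.set bex_simps by (elim disjE) simp_all
    ultimately show "\<exists>a\<in>D. \<exists>p\<in>set ?ps. \<exists>q\<in>set ?qs. \<exists>x y. e = {x, y} \<and> p a = int x \<and> q a = int y"
      using a(1) uv(1) by blast
  qed
  then show ?thesis by simp
qed

text \<open>
  The edges missed by the k main union queues are of three kinds: edges between x and its own
  mirror image (diag), path edges at a center (M1 and M2, for the indices whose centers lie on the
  path), and star edges between two numbers that are both centers at the index (S2 and S3). The
  constant 810 is the number 3 + 60 + 60 + 12 + 675 of matchings that cover them.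
\<close>

lemma coverable_complete_edges:
  assumes m: "0 < m" "2 * m * m \<le> b * b" "b \<le> 2 * m"
  shows "coverable (2 * m + 2 * b + 1 + 810) (complete_edges (8 * m + 6 * b + 3))"
proof -
  define N k H where "N = 8 * m + 6 * b + 3" and "k = 2 * m + 2 * b + 1" and "H = 4 * m + 2 * b"
  have "m < b" using less_if_double_square_le[OF m(1,2)] .
  have N: "N = H + 1 + 2 * k" by (simp add: N_def H_def k_def)
  let ?Z = "centers m b"
  have Z: "?Z a \<subseteq> {..<H}" if "a < k" for a
    using that m by (auto simp: centers_def H_def k_def)
  define L where "L = (\<Union>a<k. main_and_star_layer N k a (?Z a) (center m b a))"
  have "union_queue less_than (main_and_star_layer N k a (?Z a) (center m b a))" if "a < k" for a
    using Z[OF that] by (rule union_queue_main_and_star_layer) (use that m in \<open>auto simp: N_def H_def k_def\<close>)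
  then have L: "coverable k L"
    unfolding coverable_def L_def
    by (intro exI[of _ "\<lambda>a. main_and_star_layer N k a (?Z a) (center m b a)"] conjI allI impI subset_refl)
  define diag where "diag = (\<lambda>x. {x, mirror N x}) ` {..<H}"
  have diag: "coverable 3 diag"
    unfolding diag_def
    by (rule coverable_injective_family) (auto simp: inj_on_def mirror_def N_def H_def)
  define z1 z2 where "z1 a = 4 * m + 2 * b - a" and "z2 a = a + b - 1" for a
  define M1 where "M1 = {e. \<exists>a\<in>{1..2 * m}. e \<in> main_path N k a \<and> (z1 a \<in> e \<or> mirror N (z1 a) \<in> e)}"
  define M2 where "M2 = {e. \<exists>a\<in>{2 * m + 1..2 * m + b}. e \<in> main_path N k a \<and> (z2 a \<in> e \<or> mirror N (z2 a) \<in> e)}"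
  have M1: "coverable 60 M1"
    unfolding M1_def
    by (rule coverable_lost_main_path_edges[where c = "4 * int m + 2 * int b" and s = "-1"])
      (use \<open>m < b\<close> in \<open>auto simp: z1_def N_def k_def\<close>)
  have M2: "coverable 60 M2"
    unfolding M2_def
    by (rule coverable_lost_main_path_edges[where c = "int b - 1" and s = 1])
      (use \<open>m < b\<close> m(1) in \<open>auto simp: z2_def N_def k_def\<close>)
  define S2 where "S2 = {{z, mirror N z'} | z z' a. a \<in> {2 * m + 1..2 * m + b} \<and> z \<in> {a + b - 1, a - 1} \<and>
    z' \<in> {a + b - 1, a - 1}}"
  have S2: "coverable 12 S2"
  proof -
    let ?ps = "[\<lambda>a. int a + int b - 1, \<lambda>a. int a - 1]"
      and ?qs = "[\<lambda>a. int N - int a - int b, \<lambda>a. int N - int a]"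
    have "coverable (length ?ps * (length ?qs * 3)) S2"
    proof (rule coverable_injective_families[of "{2 * m + 1..2 * m + b}"])
      show "inj_on f {2 * m + 1..2 * m + b}" if "f \<in> set ?ps \<union> set ?qs" for f
        using that by (auto simp: inj_on_def)
      fix e assume "e \<in> S2"
      then obtain a z z' where *: "e = {z, mirror N z'}" "a \<in> {2 * m + 1..2 * m + b}"
        "z \<in> {a + b - 1, a - 1}" "z' \<in> {a + b - 1, a - 1}"
        unfolding S2_def by blast
      have "\<exists>p\<in>set ?ps. p a = int z" using * m by auto
      moreover have "\<exists>q\<in>set ?qs. q a = int (mirror N z')" using * m by (auto simp: mirror_def N_def)
      ultimately show "\<exists>a\<in>{2 * m + 1..2 * m + b}. \<exists>p\<in>set ?ps. \<exists>q\<in>set ?qs. \<exists>x y.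
          e = {x, y} \<and> p a = int x \<and> q a = int y"
        using *(1,2) by blast
    qed simp
    then show ?thesis by simp
  qed
  define S3 where "S3 = {{z, mirror N z'} | z z' a. a \<in> {2 * m + b + 1..<k} \<and> z \<in> ?Z a \<and> z' \<in> ?Z a}"
  have S3: "coverable 675 S3"
  proof -
    let ?ps = "map (\<lambda>f j. int (f j)) (center_maps m b)"
      and ?qs = "map (\<lambda>f j. int N - 1 - int (f j)) (center_maps m b)"
    have inj: "inj_on f {..<b}" if "f \<in> set (center_maps m b)" for f
      using inj_on_center_maps[OF m(1) _ that] \<open>m < b\<close> by simp
    have "coverable (length ?ps * (length ?qs * 3)) S3"
    proof (rule coverable_injective_families[of "{..<b}"])
      show "inj_on f {..<b}" if "f \<in> set ?ps \<union> set ?qs" for f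
        using that inj by (auto simp: inj_on_def)
      fix e assume "e \<in> S3"
      then obtain a z z' where *: "e = {z, mirror N z'}" "a \<in> {2 * m + b + 1..<k}" "z \<in> ?Z a" "z' \<in> ?Z a"
        unfolding S3_def by blast
      define j where "j = a - (2 * m + b + 1)"
      have j: "j \<in> {..<b}" using *(2) by (auto simp: j_def k_def)
      have Za: "?Z a = (\<lambda>f. f j) ` set (center_maps m b) \<inter> {..<a}"
        using *(2) by (auto simp: centers_def j_def)
      have "z' < H" using *(2,4) Z by auto
      have "\<exists>p\<in>set ?ps. p j = int z" using *(3) Za by auto
      moreover have "\<exists>q\<in>set ?qs. q j = int (mirror N z')"
        using *(4) Za \<open>z' < H\<close> N by (auto simp: mirror_def)
      ultimately show "\<exists>a\<in>{..<b}. \<exists>p\<in>set ?ps. \<exists>q\<in>set ?qs. \<exists>x y.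
          e = {x, y} \<and> p a = int x \<and> q a = int y"
        using *(1) j by blast
    qed simp
    then show ?thesis by (simp add: length_center_maps)
  qed
  have "coverable (k + (3 + (60 + (60 + (12 + 675))))) (L \<union> (diag \<union> (M1 \<union> (M2 \<union> (S2 \<union> S3)))))"
    by (intro coverable_Un L diag M1 M2 S2 S3)
  moreover have "complete_edges N \<subseteq> L \<union> (diag \<union> (M1 \<union> (M2 \<union> (S2 \<union> S3))))"
  proof
    fix e assume "e \<in> complete_edges N"
    then obtain x y where e: "e = {x, y}" "x < y" "y < N"
      unfolding complete_edges_def nsets_2_eq by (auto simp: doubleton_eq_iff) (metis insert_commute nat_neq_iff)
    show "e \<in> L \<union> (diag \<union> (M1 \<union> (M2 \<union> (S2 \<union> S3))))"
    proof (cases "y \<le> x + 2 * k")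
      case True
      then obtain a where a: "a < k" "e \<in> main_path N k a"
        using main_path_covers_short_edges[of x y N k] e N by auto
      show ?thesis
      proof (cases "e \<inter> (?Z a \<union> mirror N ` ?Z a) = {}")
        case True
        then have "e \<in> L" using a unfolding L_def main_and_star_layer_def by blast
        then show ?thesis by blast
      next
        case False
        then obtain z where z: "z \<in> ?Z a" "z \<in> e \<or> mirror N z \<in> e" by blast
        have "v \<ge> a \<and> v \<le> N - 1 - a" if "v \<in> e" for v
          using a(2) that unfolding main_path_def by auto
        \<comment> \<open>A center that is not below the index occurs only in the first two of the three ranges of indices.\<close>
        then have "a \<le> z" using z a(1) Z[OF a(1)] N by (force simp: mirror_def)
        then have "(a \<in> {1..2 * m} \<and> z = z1 a) \<or> (a \<in> {2 * m + 1..2 * m + b} \<and> z = z2 a)"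
          using z(1) by (auto simp: centers_def z1_def z2_def split: if_splits)
        then have "e \<in> M1 \<union> M2" using a(2) z(2) unfolding M1_def M2_def by blast
        then show ?thesis by blast
      qed
    next
      case False
      define z where "z = mirror N y"
      have y: "y = mirror N z" "x + z < H" using e False N by (auto simp: z_def mirror_def)
      show ?thesis
      proof (cases "x = z")
        case True
        then have "e \<in> diag" using y e(1) unfolding diag_def by auto
        then show ?thesis by blast
      next
        case False
        have "\<exists>a\<le>2 * m + 2 * b. (x < a \<and> center m b a x = z \<and> z \<in> ?Z a) \<or>
            (z < a \<and> center m b a z = x \<and> x \<in> ?Z a)"
        proof (cases "x < z")
          case True
          then show ?thesis using center_exists[OF m True] y(2) by (simp add: H_def)
        next
          case False
          then have "z < x" using \<open>x \<noteq> z\<close> by simp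
          then show ?thesis using center_exists[OF m \<open>z < x\<close>] y(2) by (auto simp: H_def add.commute)
        qed
        then obtain a where a: "a < k"
          "(x < a \<and> center m b a x = z \<and> z \<in> ?Z a) \<or> (z < a \<and> center m b a z = x \<and> x \<in> ?Z a)"
          by (auto simp: k_def less_Suc_eq_le)
        have exy: "e = {x, mirror N z}" using e(1) y(1) by simp
        consider "x \<in> ?Z a" "z \<in> ?Z a" | "e \<in> main_and_star_layer N k a (?Z a) (center m b a)"
          using a(2) exy unfolding main_and_star_layer_def by blast
        then show ?thesis
        proof cases
          case 1
          have "a \<noteq> 0" using 1 by (cases "a = 0") (simp_all add: centers_def)
          moreover have "\<not> a \<le> 2 * m" using 1 \<open>x \<noteq> z\<close> by (auto simp: centers_def split: if_splits)
          ultimately have "e \<in> S2 \<union> S3"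
          proof (cases "a \<le> 2 * m + b")
            case True
            then have "?Z a = {a + b - 1, a - 1}" "a \<in> {2 * m + 1..2 * m + b}"
              using \<open>\<not> a \<le> 2 * m\<close> by (auto simp: centers_def)
            then have "e \<in> S2" using 1 exy unfolding S2_def by blast
            then show ?thesis by blast
          next
            case False
            then have "a \<in> {2 * m + b + 1..<k}" using a(1) by simp
            then have "e \<in> S3" using 1 exy unfolding S3_def by blast
            then show ?thesis by blast
          qed
          then show ?thesis by blast
        next
          case 2
          then have "e \<in> L" using a(1) unfolding L_def by blast
          then show ?thesis by blast
        qed
      qed
    qed
  qed
  ultimately have "coverable (k + (3 + (60 + (60 + (12 + 675))))) (complete_edges N)"
    by (rule coverable_mono)
  then show ?thesis by (simp add: N_def k_def)
qed

text \<open>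
  The number m is chosen with n \<le> (8 + 6 sqrt 2) m, up to a bounded excess, and b is sqrt 2 m
  rounded up. The constant then follows from (1 - 1/sqrt 2)(8 + 6 sqrt 2) = 2 + 2 sqrt 2.
\<close>

lemma union_queue_number_complete_le:
  "real (union_queue_number {..<n} (complete_edges n)) \<le> (1 - 1 / sqrt 2) * real n + 823"
proof -
  define t where "t = real n / (8 + 6 * sqrt 2)"
  define m where "m = nat \<lceil>t\<rceil> + 1"
  define b where "b = nat \<lceil>sqrt 2 * real m\<rceil>"
  have sqrt2: "1 < sqrt 2" "sqrt 2 < (3/2 :: real)" "sqrt 2 * sqrt 2 = (2::real)"
    by (auto intro!: real_less_lsqrt simp: power2_eq_square simp del: less_divide_eq_numeral1)
  have "0 \<le> t" by (simp add: t_def)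
  then have mt: "t \<le> real m" "real m \<le> t + 2" "0 < m" by (auto simp: m_def) linarith+
  have "0 \<le> sqrt 2 * real m" by simp
  then have b: "sqrt 2 * real m \<le> real b" "real b \<le> sqrt 2 * real m + 1" unfolding b_def by linarith+
  have "2 * m * m \<le> b * b"
  proof -
    have "(sqrt 2 * real m) * (sqrt 2 * real m) \<le> real b * real b"
      using b(1) by (intro mult_mono) auto
    moreover have "(sqrt 2 * real m) * (sqrt 2 * real m) = (sqrt 2 * sqrt 2) * real (m * m)"
      by (simp only: of_nat_mult mult_ac)
    ultimately have "real (2 * m * m) \<le> real (b * b)" unfolding sqrt2(3) by simp
    then show ?thesis by (simp only: of_nat_le_iff)
  qed
  moreover have "b \<le> 2 * m"
  proof -
    have "sqrt 2 * real m \<le> real (2 * m)" using sqrt2(2) mt(3) by simp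
    then show ?thesis unfolding b_def by linarith
  qed
  ultimately have cov: "coverable (2 * m + 2 * b + 1 + 810) (complete_edges (8 * m + 6 * b + 3))"
    using mt(3) by (intro coverable_complete_edges)
  have n: "real n = 8 * t + 6 * (sqrt 2 * t)"
  proof -
    have "8 + 6 * sqrt 2 \<noteq> (0 :: real)" using sqrt2(1) by linarith
    then have "(8 + 6 * sqrt 2) * t = real n" by (simp add: t_def)
    then show ?thesis by (simp add: algebra_simps)
  qed
  have "sqrt 2 * t \<le> sqrt 2 * real m" using mt(1) by simp
  then have "real n \<le> 8 * real m + 6 * real b + 3" using n mt(1) b(1) by linarith
  then have "real n \<le> real (8 * m + 6 * b + 3)" by simp
  then have "n \<le> 8 * m + 6 * b + 3" by (simp only: of_nat_le_iff)
  then have "complete_edges n \<subseteq> complete_edges (8 * m + 6 * b + 3)"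
    unfolding complete_edges_def by (intro nsets_mono) auto
  then have "union_queue_number {..<n} (complete_edges n) \<le> 2 * m + 2 * b + 1 + 810"
    by (intro union_queue_number_le coverable_mono[OF cov])
  then have "real (union_queue_number {..<n} (complete_edges n)) \<le> 2 * real m + 2 * real b + 811"
    by linarith
  also have "\<dots> \<le> 2 * t + 2 * (sqrt 2 * t) + 823"
  proof -
    have "sqrt 2 * real m \<le> sqrt 2 * (t + 2)" using mt(2) by simp
    then show ?thesis using mt(2) b(2) sqrt2(2) by (simp add: algebra_simps)
  qed
  also have "2 * t + 2 * (sqrt 2 * t) = (1 - 1 / sqrt 2) * real n"
  proof -
    have "1 / sqrt 2 = sqrt 2 / 2" using sqrt2 by (simp add: field_simps)
    then have "(1 - 1 / sqrt 2) * (8 + 6 * sqrt 2) = 2 + 2 * sqrt 2"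
      using sqrt2(3) by (simp add: algebra_simps)
    moreover have "real n = (8 + 6 * sqrt 2) * t" using n
      by (simp add: algebra_simps)
    ultimately have "(1 - 1 / sqrt 2) * real n = (2 + 2 * sqrt 2) * t" by (simp add: mult.assoc)
    then show ?thesis by (simp add: algebra_simps)
  qed
  finally show ?thesis .
qed

theorem theorem1:
  shows "\<exists>c::real. \<forall>n::nat. n \<ge> 1 \<longrightarrow>
    \<bar>real (local_queue_number {..<n} (complete_edges n)) - (1 - 1 / sqrt 2) * real n\<bar> \<le> c \<and>
    \<bar>real (union_queue_number {..<n} (complete_edges n)) - (1 - 1 / sqrt 2) * real n\<bar> \<le> c"
proof (intro exI[of _ 823] allI impI)
  fix n :: nat
  have "local_queue_number {..<n} (complete_edges n) \<le> union_queue_number {..<n} (complete_edges n)"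
    by (rule local_queue_number_le_union_queue_number[OF simple_graph_complete])
  then have "real (local_queue_number {..<n} (complete_edges n))
      \<le> real (union_queue_number {..<n} (complete_edges n))"
    by simp
  then show "\<bar>real (local_queue_number {..<n} (complete_edges n)) - (1 - 1 / sqrt 2) * real n\<bar> \<le> 823 \<and>
    \<bar>real (union_queue_number {..<n} (complete_edges n)) - (1 - 1 / sqrt 2) * real n\<bar> \<le> 823"
    using local_queue_number_complete_ge[of n] union_queue_number_complete_le[of n]
    unfolding abs_le_iff by linarith
qed

end
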